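(* Let $n,k$ be positive integers and let $(Q,\cdot)$ be a $k$-translatable quasigroup of order $n$, with $Q=\{1,2,\ldots,n\}$. Then the following statements are equivalent: (a) $(Q,\cdot)$ is quadratical; (b) $[i+k(z\cdot i)]_n=[(j\cdot z)+k(i\cdot j)]_n$ for all $i,j,z\in Q$; (c) $[(z\cdot i)+k(j\cdot z)]_n=[ki+(i\cdot j)]_n$ for all $i,j,z\in Q$, and $[k^2]_n=[-1]_n$; (d) $(Q,\cdot)$ is idempotent and medial, and $[k^2]_n=[-1]_n$.
   Context: For an integer $m$, $[m]_n$ denotes the residue class of $m$ modulo $n$, represented in $\{1,\ldots,n\}$ (so $0=n$); $[u]_n=[v]_n$ means $u\equiv v \pmod n$. A groupoid is a set with a binary operation. A groupoid on $Q=\{1,\ldots,n\}$ (with natural ordering $1,2,\ldots,n$) is $k$-translatable if $i\cdot j=[i+1]_n\cdot[j+k]_n$ for all $i,j\in Q$; equivalently $i\cdot j=a_{[k-ki+j]_n}$, where $a_1,\ldots,a_n$ is the first row of the multiplication table ($a_j=1\cdot j$). A quasigroup is a groupoid in which $ax=b$ and $xa=b$ are uniquely solvable for $x$. A quasigroup is quadratical if it satisfies $(x\cdot y)\cdot x=(z\cdot x)\cdot(y\cdot z)$; idempotent if $x\cdot x=x$; medial if $(x\cdot y)\cdot(z\cdot w)=(x\cdot z)\cdot(y\cdot w)$. In (b) and (c) the expressions combine products in $Q$ with integer addition and multiplication, elements of $Q$ being regarded as integers. *)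

theory Defs
  imports "HOL-Number_Theory.Cong"
begin

definition groupoid_on :: "'a set \<Rightarrow> ('a \<Rightarrow> 'a \<Rightarrow> 'a) \<Rightarrow> bool" where
  "groupoid_on Q f \<longleftrightarrow> (\<forall>x\<in>Q. \<forall>y\<in>Q. f x y \<in> Q)"

definition quasigroup_on :: "'a set \<Rightarrow> ('a \<Rightarrow> 'a \<Rightarrow> 'a) \<Rightarrow> bool" where
  "quasigroup_on Q f \<longleftrightarrow> groupoid_on Q f \<and>
     (\<forall>a\<in>Q. \<forall>b\<in>Q. (\<exists>!x. x \<in> Q \<and> f a x = b) \<and> (\<exists>!x. x \<in> Q \<and> f x a = b))"

definition quadratical_on :: "'a set \<Rightarrow> ('a \<Rightarrow> 'a \<Rightarrow> 'a) \<Rightarrow> bool" where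
  "quadratical_on Q f \<longleftrightarrow> quasigroup_on Q f \<and>
     (\<forall>x\<in>Q. \<forall>y\<in>Q. \<forall>z\<in>Q. f (f x y) x = f (f z x) (f y z))"

definition idempotent_on :: "'a set \<Rightarrow> ('a \<Rightarrow> 'a \<Rightarrow> 'a) \<Rightarrow> bool" where
  "idempotent_on Q f \<longleftrightarrow> (\<forall>x\<in>Q. f x x = x)"

definition medial_on :: "'a set \<Rightarrow> ('a \<Rightarrow> 'a \<Rightarrow> 'a) \<Rightarrow> bool" where
  "medial_on Q f \<longleftrightarrow>
     (\<forall>x\<in>Q. \<forall>y\<in>Q. \<forall>z\<in>Q. \<forall>w\<in>Q. f (f x y) (f z w) = f (f x z) (f y w))"

text \<open>
  The representative of the class of \<open>m\<close> modulo \<open>n\<close> in \<open>{1..n}\<close> (for \<open>n > 0\<close>);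
  unlike for \<open>m mod n\<close>, the zero class is represented by \<open>n\<close>.
\<close>

definition residue :: "int \<Rightarrow> int \<Rightarrow> int" where
  "residue n m = (m - 1) mod n + 1"

lemma residue_in_range: "n > 0 \<Longrightarrow> residue n m \<in> {1..n}"
  using pos_mod_bound[of n "m - 1"] pos_mod_sign[of n "m - 1"]
  unfolding residue_def atLeastAtMost_iff by linarith

lemma cong_residue: "[residue n m = m] (mod n)"
  by (simp add: residue_def cong_def mod_simps)

lemma residue_eq_iff_cong: "residue n u = residue n v \<longleftrightarrow> [u = v] (mod n)"
  by (simp add: residue_def cong_def mod_eq_dvd_iff)

text \<open>
  Translatability with respect to the natural ordering of \<open>{1..n}\<close>.
\<close>

definition translatable :: "int \<Rightarrow> int \<Rightarrow> (int \<Rightarrow> int \<Rightarrow> int) \<Rightarrow> bool" where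
  "translatable n k f \<longleftrightarrow> groupoid_on {1..n} f \<and>
     (\<forall>i\<in>{1..n}. \<forall>j\<in>{1..n}. f i j = f (residue n (i + 1)) (residue n (j + k)))"

end

theory Submission
  imports Defs
begin

text \<open>
  The product depends only on the residue class of \<open>j - k * i\<close>, and injectively so; hence the
  quadratical identity is literally (b). Idempotency gives \<open>(1 - k) * (i \<cdot> j) \<equiv> j - k * i\<close>
  with \<open>1 - k\<close> cancellable, so that every remaining identity becomes a linear congruence in
  \<open>i\<close>, \<open>j\<close>, \<open>z\<close>; multiplication by \<open>k\<close>, where \<open>k\<^sup>2 \<equiv> -1\<close>, exchanges (b) and (c).
\<close>

lemma residue_self: "i \<in> {1..n} \<Longrightarrow> residue n i = i"
  by (simp add: residue_def)

lemma cong_eq_in_range: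
  "\<lbrakk>[u = v] (mod n); u \<in> {1..n}; v \<in> {1..n}\<rbrakk> \<Longrightarrow> u = v" for n :: int
  by (metis residue_eq_iff_cong residue_self)

text \<open>Induction on the row \<open>i\<close>: passing to the next row shifts the entries by
  \<open>k\<close> columns, so the offset drops by \<open>k\<close> at each step. The summand
  \<open>+ k\<close> makes the offset vanish for row 1.\<close>

lemma translatable_first_row:
  assumes "n > 0" "translatable n k f" "i \<in> {1..n}" "j \<in> {1..n}"
  shows "f i j = f 1 (residue n (j - k * i + k))"
proof -
  have "\<forall>j\<in>{1..n}. f i j = f 1 (residue n (j - k * i + k))" if "1 \<le> i" "i \<le> n" for i
    using that
  proof (induction i rule: int_ge_induct)
    case base
    then show ?case by (simp add: residue_self)
  next
    case (step i)
    show ?case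
    proof
      fix j assume j: "j \<in> {1..n}"
      \<comment> \<open>Translatability pushes entries forward, so column \<open>j\<close> of row
        \<open>i + 1\<close> is traced back to the column \<open>m\<close> of row \<open>i\<close>
        that is carried onto it.\<close>
      define m where "m = residue n (j - k)"
      have m: "m \<in> {1..n}" using assms(1) by (simp only: m_def residue_in_range)
      have cm: "[m = j - k] (mod n)" by (simp add: m_def cong_residue)
      have "[m + k = j] (mod n)" using cong_add[OF cm cong_refl[of k]] by simp
      then have r: "residue n (m + k) = j" using j by (metis residue_eq_iff_cong residue_self)
      have "f i m = f (residue n (i + 1)) (residue n (m + k))"
        using assms(2) step m unfolding translatable_def by simp
      then have "f (i + 1) j = f i m" using r step by (simp add: residue_self)
      also have "\<dots> = f 1 (residue n (m - k * i + k))" using step m by simp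
      also have "residue n (m - k * i + k) = residue n (j - k * (i + 1) + k)"
        unfolding residue_eq_iff_cong
        using cong_add[OF cm cong_refl[of "k - k * i"]] by (simp add: algebra_simps)
      finally show "f (i + 1) j = f 1 (residue n (j - k * (i + 1) + k))" .
    qed
  qed
  then show ?thesis using assms(3,4) by simp
qed

text \<open>Every product is an entry of the first row, and left cancellation by 1 makes that row
  injective. Equality of products thus becomes equality of column indices, where the common
  \<open>+ k\<close> cancels.\<close>

lemma translatable_quasigroup_eq_iff:
  assumes "n > 0" "quasigroup_on {1..n} f" "translatable n k f"
    and "i \<in> {1..n}" "j \<in> {1..n}" "x \<in> {1..n}" "y \<in> {1..n}"
  shows "f i j = f x y \<longleftrightarrow> [j - k * i = y - k * x] (mod n)"
proof -
  have inj: "u = v" if "f 1 u = f 1 v" "u \<in> {1..n}" "v \<in> {1..n}" for u v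
  proof -
    have "1 \<in> {1..n}" "f 1 u \<in> {1..n}"
      using assms(1,2) that unfolding quasigroup_on_def groupoid_on_def by auto
    then have "\<exists>!w. w \<in> {1..n} \<and> f 1 w = f 1 u"
      using assms(2) unfolding quasigroup_on_def by blast
    then show ?thesis using that by metis
  qed
  have "f i j = f x y \<longleftrightarrow> residue n (j - k * i + k) = residue n (y - k * x + k)"
    using translatable_first_row[OF assms(1,3)] inj assms residue_in_range by metis
  then show ?thesis by (simp add: residue_eq_iff_cong cong_add_rcancel)
qed

lemma quasigroup_on_closed:
  "\<lbrakk>quasigroup_on Q f; x \<in> Q; y \<in> Q\<rbrakk> \<Longrightarrow> f x y \<in> Q"
  by (simp add: quasigroup_on_def groupoid_on_def)

text \<open>With \<open>c = f i j\<close>, idempotency gives \<open>f c c = f i j\<close>; comparing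
  \<open>c - k * c\<close> with \<open>j - k * i\<close> yields the claim.\<close>

lemma translatable_idempotent_linear:
  assumes "n > 0" "quasigroup_on {1..n} f" "translatable n k f" "idempotent_on {1..n} f"
    and "i \<in> {1..n}" "j \<in> {1..n}"
  shows "[(1 - k) * f i j = j - k * i] (mod n)"
proof -
  have c: "f i j \<in> {1..n}" using quasigroup_on_closed assms by metis
  then have "f (f i j) (f i j) = f i j" using assms(4) unfolding idempotent_on_def by blast
  then have "[f i j - k * f i j = j - k * i] (mod n)"
    using translatable_quasigroup_eq_iff[OF assms(1-3)] c assms(5,6) by metis
  then show ?thesis by (simp add: algebra_simps)
qed

text \<open>No coprimality argument is made: the diagonal entry \<open>f u u\<close> is determined
  by the class of \<open>(1 - k) * u\<close>, and by idempotency it equals \<open>u\<close>.\<close>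

lemma translatable_idempotent_cancel:
  assumes "n > 0" "quasigroup_on {1..n} f" "translatable n k f" "idempotent_on {1..n} f"
    and "[(1 - k) * u = (1 - k) * v] (mod n)"
  shows "[u = v] (mod n)"
proof -
  \<comment> \<open>The integers \<open>u\<close> and \<open>v\<close> are arbitrary, while
    \<open>f\<close> is controlled only on \<open>{1..n}\<close>.\<close>
  let ?u = "residue n u" and ?v = "residue n v"
  have r: "?u \<in> {1..n}" "?v \<in> {1..n}" using residue_in_range[OF assms(1)] by blast+
  have "[(1 - k) * ?u = (1 - k) * u] (mod n)" "[(1 - k) * ?v = (1 - k) * v] (mod n)"
    by (intro cong_mult cong_refl cong_residue)+
  then have "[(1 - k) * ?u = (1 - k) * ?v] (mod n)"
    using assms(5) by (meson cong_trans cong_sym)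
  then have "[?u - k * ?u = ?v - k * ?v] (mod n)" by (simp add: algebra_simps)
  then have "f ?u ?u = f ?v ?v"
    using translatable_quasigroup_eq_iff[OF assms(1-3)] r by metis
  then have "?u = ?v" using assms(4) r unfolding idempotent_on_def by metis
  then show ?thesis by (simp add: residue_eq_iff_cong)
qed

text \<open>Scaled by \<open>1 - k\<close>, the invariant of the left-hand product becomes
  \<open>w - k * z - k * y + k * k * x\<close>, which is symmetric in \<open>y\<close> and
  \<open>z\<close>.\<close>

lemma translatable_idempotent_medial:
  assumes "n > 0" "quasigroup_on {1..n} f" "translatable n k f" "idempotent_on {1..n} f"
  shows "medial_on {1..n} f"
  unfolding medial_on_def
proof (intro ballI)
  fix x y z w assume m: "x \<in> {1..n}" "y \<in> {1..n}" "z \<in> {1..n}" "w \<in> {1..n}"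
  note lin = translatable_idempotent_linear[OF assms]
  note closed = quasigroup_on_closed[OF assms(2)]
  have "[f z w - k * f x y = f y w - k * f x z] (mod n)"
  proof (rule translatable_idempotent_cancel[OF assms])
    have a: "[(1 - k) * f u v - k * ((1 - k) * f s t) = (v - k * u) - k * (t - k * s)] (mod n)"
      if "u \<in> {1..n}" "v \<in> {1..n}" "s \<in> {1..n}" "t \<in> {1..n}" for u v s t
      using that lin by (intro cong_diff cong_mult cong_refl)
    have "[(1 - k) * f z w - k * ((1 - k) * f x y) = (1 - k) * f y w - k * ((1 - k) * f x z)] (mod n)"
      using a[of z w x y] a[of y w x z] m
      by (simp add: algebra_simps cong_def)
    then show "[(1 - k) * (f z w - k * f x y) = (1 - k) * (f y w - k * f x z)] (mod n)"
      by (simp add: algebra_simps)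
  qed
  then show "f (f x y) (f z w) = f (f x z) (f y w)"
    using translatable_quasigroup_eq_iff[OF assms(1-3)] closed m by metis
qed

text \<open>The equality criterion turns each instance of the quadratical identity into a
  congruence; moving the negative terms across gives (b).\<close>

lemma translatable_quadratical_iff:
  assumes "n > 0" "quasigroup_on {1..n} f" "translatable n k f"
  shows "quadratical_on {1..n} f \<longleftrightarrow>
    (\<forall>i\<in>{1..n}. \<forall>j\<in>{1..n}. \<forall>z\<in>{1..n}. [i + k * f z i = f j z + k * f i j] (mod n))"
proof -
  note closed = quasigroup_on_closed[OF assms(2)]
  have "f (f i j) i = f (f z i) (f j z) \<longleftrightarrow> [i + k * f z i = f j z + k * f i j] (mod n)"
    if "i \<in> {1..n}" "j \<in> {1..n}" "z \<in> {1..n}" for i j z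
  proof -
    have "f (f i j) i = f (f z i) (f j z) \<longleftrightarrow> [i - k * f i j = f j z - k * f z i] (mod n)"
      using translatable_quasigroup_eq_iff[OF assms] closed that by metis
    also have "\<dots> \<longleftrightarrow> [i + k * f z i = f j z + k * f i j] (mod n)"
      by (simp add: cong_iff_dvd_diff algebra_simps)
    finally show ?thesis .
  qed
  then show ?thesis using assms(2) unfolding quadratical_on_def by blast
qed

lemma translatable_quadratical_idempotent:
  assumes "n > 0" "quasigroup_on {1..n} f" "translatable n k f" "quadratical_on {1..n} f"
  shows "idempotent_on {1..n} f"
  unfolding idempotent_on_def
proof
  fix x assume x: "x \<in> {1..n}"
  \<comment> \<open>This is (b) with all three variables equal to \<open>x\<close>.\<close>
  then have "[x + k * f x x = f x x + k * f x x] (mod n)"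
    using translatable_quadratical_iff[OF assms(1-3)] assms(4) by blast
  then have "[f x x = x] (mod n)" by (simp add: cong_add_rcancel cong_sym)
  then show "f x x = x" using cong_eq_in_range quasigroup_on_closed[OF assms(2)] x by blast
qed

text \<open>Scaled by \<open>1 - k\<close>, the two sides become \<open>i - k * k * z\<close> and
  \<open>z - k * k * i\<close>: the terms in \<open>j\<close> cancel, and the difference
  factors.\<close>

lemma translatable_idempotent_identity_iff:
  assumes "n > 0" "quasigroup_on {1..n} f" "translatable n k f" "idempotent_on {1..n} f"
    and "i \<in> {1..n}" "j \<in> {1..n}" "z \<in> {1..n}"
  shows "[i + k * f z i = f j z + k * f i j] (mod n) \<longleftrightarrow> n dvd (k\<^sup>2 + 1) * (i - z)"
proof -
  note lin = translatable_idempotent_linear[OF assms(1-4)]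
  have "[i + k * f z i = f j z + k * f i j] (mod n) \<longleftrightarrow>
      [(1 - k) * (i + k * f z i) = (1 - k) * (f j z + k * f i j)] (mod n)"
    using translatable_idempotent_cancel[OF assms(1-4)] cong_scalar_left by blast
  also have "\<dots> \<longleftrightarrow> [(1 - k) * i + k * ((1 - k) * f z i) = (1 - k) * f j z + k * ((1 - k) * f i j)] (mod n)"
    by (simp add: algebra_simps)
  also have "\<dots> \<longleftrightarrow> [(1 - k) * i + k * (i - k * z) = (z - k * j) + k * (j - k * i)] (mod n)"
  proof -
    have "[(1 - k) * i + k * ((1 - k) * f z i) = (1 - k) * i + k * (i - k * z)] (mod n)"
      "[(1 - k) * f j z + k * ((1 - k) * f i j) = (z - k * j) + k * (j - k * i)] (mod n)"
      using assms(5-7) lin by (intro cong_add cong_mult cong_refl; blast)+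
    then show ?thesis by (simp add: cong_def)
  qed
  also have "\<dots> \<longleftrightarrow> n dvd (k\<^sup>2 + 1) * (i - z)"
    by (simp add: cong_iff_dvd_diff algebra_simps power2_eq_square)
  finally show ?thesis .
qed

lemma translatable_quadratical_iff_idempotent:
  assumes "n > 0" "quasigroup_on {1..n} f" "translatable n k f"
  shows "quadratical_on {1..n} f \<longleftrightarrow> idempotent_on {1..n} f \<and> [k\<^sup>2 = -1] (mod n)"
proof
  assume q: "quadratical_on {1..n} f"
  then have id: "idempotent_on {1..n} f"
    by (rule translatable_quadratical_idempotent[OF assms])
  \<comment> \<open>The choice \<open>i = 1\<close>, \<open>z = n\<close> makes \<open>i - z\<close>
    congruent to 1, so the other factor \<open>k\<^sup>2 + 1\<close> is isolated. It also covers
    \<open>n = 1\<close>, where the two elements coincide.\<close>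
  have "1 \<in> {1..n}" "n \<in> {1..n}" using assms(1) by auto
  then have "n dvd (k\<^sup>2 + 1) * (1 - n)"
    using translatable_idempotent_identity_iff[OF assms id]
      translatable_quadratical_iff[OF assms] q by blast
  then have "n dvd (k\<^sup>2 + 1) * (1 - n) + n * (k\<^sup>2 + 1)" by (intro dvd_add dvd_triv_left)
  then have "n dvd k\<^sup>2 + 1" by (simp add: algebra_simps)
  then show "idempotent_on {1..n} f \<and> [k\<^sup>2 = -1] (mod n)"
    using id by (simp add: cong_iff_dvd_diff)
next
  assume r: "idempotent_on {1..n} f \<and> [k\<^sup>2 = -1] (mod n)"
  then have "n dvd k\<^sup>2 + 1" by (simp add: cong_iff_dvd_diff)
  then show "quadratical_on {1..n} f"
    using translatable_quadratical_iff[OF assms] translatable_idempotent_identity_iff[OF assms] r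
    by (meson dvd_mult2)
qed

text \<open>Here \<open>k\<close> is a unit with inverse \<open>-k\<close>. Multiplying the first
  congruence by \<open>k\<close> and replacing \<open>k\<^sup>2\<close> by -1 gives the second up to
  sign.\<close>

lemma cong_mult_sqrt_minus_one_iff:
  fixes k n a b c d :: int
  assumes "[k\<^sup>2 = -1] (mod n)"
  shows "[a + k * b = c + k * d] (mod n) \<longleftrightarrow> [b + k * c = k * a + d] (mod n)"
proof -
  have k: "n dvd k\<^sup>2 + 1" using assms by (simp add: cong_iff_dvd_diff)
  let ?p = "a + k * b - (c + k * d)" and ?q = "b + k * c - (k * a + d)"
  have "?q = (k\<^sup>2 + 1) * (b - d) - k * ?p" "?p = (k\<^sup>2 + 1) * (a - c) + k * ?q"
    by (simp_all add: algebra_simps power2_eq_square)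
  then have "n dvd ?p \<longleftrightarrow> n dvd ?q"
    using k by (metis dvd_add dvd_diff dvd_mult dvd_mult2)
  then show ?thesis by (simp only: cong_iff_dvd_diff)
qed

theorem theorem3p3:
  fixes n k :: int and Q :: "int set" and f :: "int \<Rightarrow> int \<Rightarrow> int"
  assumes "n > 0" and "k > 0"
    and "Q = {1..n}"
    and "quasigroup_on Q f"
    and "translatable n k f"
  shows "(quadratical_on Q f \<longleftrightarrow>
           (\<forall>i\<in>Q. \<forall>j\<in>Q. \<forall>z\<in>Q. [i + k * f z i = f j z + k * f i j] (mod n)))
       \<and> (quadratical_on Q f \<longleftrightarrow>
           (\<forall>i\<in>Q. \<forall>j\<in>Q. \<forall>z\<in>Q. [f z i + k * f j z = k * i + f i j] (mod n))
           \<and> [k\<^sup>2 = -1] (mod n))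
       \<and> (quadratical_on Q f \<longleftrightarrow>
           idempotent_on Q f \<and> medial_on Q f \<and> [k\<^sup>2 = -1] (mod n))"
proof -
  have qg: "quasigroup_on {1..n} f" using assms by simp
  note b = translatable_quadratical_iff[OF assms(1) qg assms(5), folded assms(3)]
  note d = translatable_quadratical_iff_idempotent[OF assms(1) qg assms(5), folded assms(3)]
  note medial = translatable_idempotent_medial[OF assms(1) qg assms(5), folded assms(3)]
  \<comment> \<open>The exchange applies with \<open>a = i\<close>, \<open>b = f z i\<close>,
    \<open>c = f j z\<close>, \<open>d = f i j\<close>. Its premise on \<open>k\<^sup>2\<close>
    comes from the fact \<open>d\<close> in one direction and from (c) itself in the other.\<close>
  have "quadratical_on Q f \<longleftrightarrow>
      (\<forall>i\<in>Q. \<forall>j\<in>Q. \<forall>z\<in>Q. [f z i + k * f j z = k * i + f i j] (mod n)) \<and> [k\<^sup>2 = -1] (mod n)"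
    using b d cong_mult_sqrt_minus_one_iff by meson
  then show ?thesis using b d medial by blast
qed

end
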